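(* Let $G$ be a topological group whose topology is Suslin, let $X$ be a Hausdorff topological space, and let $G\times X\to X$, $(g,x)\mapsto g.x$, be a separately continuous group action such that no orbit $\{g.x : g\in G\}$ ($x\in X$) is meagre in $X$. Then for every $x\in X$ the map $G\to X$, $g\mapsto g.x$, is open, and all orbits are closed and open in $X$.
   Context: A polish space is a separable topological space whose topology is induced by a complete metric. A Hausdorff topological space $Y$ is called a Suslin space if there are a polish space $P$ and a continuous surjection $P\to Y$. A topological group is a group $G$ endowed with a topology such that $G\times G\to G$, $(x,y)\mapsto xy^{-1}$, is continuous. A group action satisfies $g.(h.x)=(gh).x$ and $e.x=x$ for all $g,h\in G$ and $x\in X$, where $e$ is the neutral element. Separately continuous means that $g\mapsto g.x$ is continuous for each fixed $x\in X$ and $x\mapsto g.x$ is continuous for each fixed $g\in G$. A subset of a topological space is meagre if it is contained in a countable union of closed sets with empty interiors. *)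

theory Defs
  imports "HOL-Analysis.Analysis" "HOL-Algebra.Group_Action"
begin

definition polish_topology :: "'a topology \<Rightarrow> bool" where
  "polish_topology P \<longleftrightarrow> separable_space P \<and> completely_metrizable_space P"

text \<open>HOL cannot quantify over types inside a formula, so the type over which the Polish
  space lives is an explicit parameter. In a theorem with hypothesis
  \<open>suslin_space TYPE('p) Y\<close> and \<open>'p\<close> occurring nowhere else, the type \<open>'p\<close> is universally
  quantified, so the theorem covers every Suslin space \<open>Y\<close>, whatever type its Polish
  parametrisation lives on.\<close>

definition suslin_space :: "'p itself \<Rightarrow> 'a topology \<Rightarrow> bool" where
  "suslin_space (_ :: 'p itself) Y \<longleftrightarrow>
     Hausdorff_space Y \<and>
     (\<exists>(P :: 'p topology) f.
        polish_topology P \<and> continuous_map P Y f \<and> f ` topspace P = topspace Y)"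

definition topological_group :: "('g, 'm) monoid_scheme \<Rightarrow> 'g topology \<Rightarrow> bool" where
  "topological_group G T \<longleftrightarrow>
     group G \<and> topspace T = carrier G \<and>
     continuous_map (prod_topology T T) T (\<lambda>(x, y). x \<otimes>\<^bsub>G\<^esub> inv\<^bsub>G\<^esub> y)"

definition separately_continuous_map ::
    "'a topology \<Rightarrow> 'b topology \<Rightarrow> 'c topology \<Rightarrow> ('a \<Rightarrow> 'b \<Rightarrow> 'c) \<Rightarrow> bool" where
  "separately_continuous_map S X Y f \<longleftrightarrow>
     (\<forall>x \<in> topspace X. continuous_map S Y (\<lambda>s. f s x)) \<and>
     (\<forall>s \<in> topspace S. continuous_map X Y (\<lambda>x. f s x))"

definition meagre_in :: "'a topology \<Rightarrow> 'a set \<Rightarrow> bool" where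
  "meagre_in X S \<longleftrightarrow>
     (\<exists>\<F>. countable \<F> \<and> (\<forall>C \<in> \<F>. closedin X C \<and> X interior_of C = {}) \<and> S \<subseteq> \<Union>\<F>)"

text \<open>The locale \<open>group_action\<close> asks for a homomorphism into the group of bijections of \<open>E\<close>,
  represented by functions that are \<open>undefined\<close> outside \<open>E\<close>. Up to this normalisation
  it is the usual notion of a left action.\<close>

lemma group_action_restrict_iff:
  fixes G (structure)
  assumes "group G"
  shows "group_action G E (\<lambda>g. restrict (\<phi> g) E) \<longleftrightarrow>
    (\<forall>g \<in> carrier G. \<forall>x \<in> E. \<phi> g x \<in> E) \<and>
    (\<forall>g \<in> carrier G. \<forall>h \<in> carrier G. \<forall>x \<in> E. \<phi> g (\<phi> h x) = \<phi> (g \<otimes> h) x) \<and>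
    (\<forall>x \<in> E. \<phi> \<one> x = x)"
    (is "?A \<longleftrightarrow> ?B")
proof
  assume ?A
  then interpret group_action G E "\<lambda>g. restrict (\<phi> g) E" .
  have cl: "\<phi> g x \<in> E" if "g \<in> carrier G" "x \<in> E" for g x
    using element_image[OF that refl] that by simp
  moreover have "\<phi> g (\<phi> h x) = \<phi> (g \<otimes> h) x"
    if "g \<in> carrier G" "h \<in> carrier G" "x \<in> E" for g h x
    using composition_rule[OF that(3,1,2)] that cl by simp
  moreover have "\<phi> \<one> x = x" if "x \<in> E" for x
    using fun_cong[OF id_eq_one, of x] that by simp
  ultimately show ?B by blast
next
  assume B: ?B
  interpret group G by fact
  have bij: "bij_betw (\<phi> g) E E" if g: "g \<in> carrier G" for g
    by (rule bij_betwI[where g = "\<phi> (inv g)"]) (use B g in auto)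
  have "(\<lambda>g. restrict (\<phi> g) E) \<in> hom G (BijGroup E)"
  proof (rule homI)
    fix g assume "g \<in> carrier G"
    then show "restrict (\<phi> g) E \<in> carrier (BijGroup E)"
      using bij by (simp add: BijGroup_def Bij_def bij_betw_cong[of E "restrict (\<phi> g) E" "\<phi> g"])
  next
    fix g h assume gh: "g \<in> carrier G" "h \<in> carrier G"
    then have "restrict (\<phi> g) E \<in> Bij E" "restrict (\<phi> h) E \<in> Bij E"
      using bij by (simp_all add: Bij_def bij_betw_cong[of E "restrict (\<phi> _) E" "\<phi> _"])
    then show "restrict (\<phi> (g \<otimes> h)) E =
        restrict (\<phi> g) E \<otimes>\<^bsub>BijGroup E\<^esub> restrict (\<phi> h) E"
      using B gh by (auto simp: BijGroup_def compose_def fun_eq_iff)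
  qed
  then show ?A
    by (intro group_action.intro group_hom.intro group_hom_axioms.intro group_BijGroup assms)
qed

end

theory Submission
  imports Defs
begin

text \<open>A continuous image \<open>A\<close> of a Polish space in a Hausdorff space has the Baire property, so if it
  is nonmeagre, it is comeagre in some open set that it meets. Since \<open>G\<close> is Lindelof, countably
  many translates of an identity neighbourhood \<open>V\<close> cover \<open>G\<close>; hence every \<open>V.x\<close> is nonmeagre and
  nonempty open subsets of \<open>X\<close> are nonmeagre. Applied to \<open>A = V.x\<close>, this makes \<open>V\<inverse>V.x\<close> comeagre in
  a neighbourhood \<open>N\<close> of \<open>x\<close>. The same holds at any \<open>y \<in> N\<close>, because the orbit of \<open>y\<close> is nonmeagre
  too; so \<open>V\<inverse>V.x\<close> and \<open>V\<inverse>V.y\<close> are comeagre in a common nonempty open set and meet. Therefore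
  \<open>N \<subseteq> (V\<inverse>V)\<inverse>(V\<inverse>V).x\<close>, which gives openness of the orbit maps.\<close>

section \<open>Meagre sets\<close>

lemma meagre_in_subset: "meagre_in X T \<Longrightarrow> S \<subseteq> T \<Longrightarrow> meagre_in X S"
  unfolding meagre_in_def by (meson order.trans)

lemma meagre_in_empty [simp]: "meagre_in X {}"
  unfolding meagre_in_def by (intro exI[of _ "{}"]) auto

lemma meagre_in_nowhere_dense:
  "closedin X C \<Longrightarrow> X interior_of C = {} \<Longrightarrow> meagre_in X C"
  unfolding meagre_in_def by (intro exI[of _ "{C}"]) auto

lemma meagre_in_UN:
  assumes "countable I" "\<And>i. i \<in> I \<Longrightarrow> meagre_in X (S i)"
  shows "meagre_in X (\<Union>i\<in>I. S i)"
proof -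
  obtain \<F> where \<F>: "\<And>i. i \<in> I \<Longrightarrow> countable (\<F> i)"
    "\<And>i C. i \<in> I \<Longrightarrow> C \<in> \<F> i \<Longrightarrow> closedin X C \<and> X interior_of C = {}"
    "\<And>i. i \<in> I \<Longrightarrow> S i \<subseteq> \<Union>(\<F> i)"
    using assms(2) unfolding meagre_in_def by metis
  have "countable (\<Union>i\<in>I. \<F> i)"
    using assms(1) \<F>(1) by blast
  moreover have "(\<Union>i\<in>I. S i) \<subseteq> \<Union>(\<Union>i\<in>I. \<F> i)"
    using \<F>(3) by blast
  ultimately show ?thesis
    unfolding meagre_in_def using \<F>(2) by (intro exI[of _ "\<Union>i\<in>I. \<F> i"]) blast
qed

lemma meagre_in_Un:
  assumes "meagre_in X S" "meagre_in X T"
  shows "meagre_in X (S \<union> T)"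
  using meagre_in_UN[of "{S, T}" X "\<lambda>A. A"] assms by auto

text \<open>The interior is the largest open subset of \<open>C\<close>, so an open set inside the
  difference lies both in the interior and outside it, hence is empty.\<close>

lemma meagre_in_closedin_diff_interior:
  assumes "closedin X C"
  shows "meagre_in X (C - X interior_of C)"
proof (rule meagre_in_nowhere_dense)
  show "closedin X (C - X interior_of C)"
    using assms by (simp add: closedin_diff)
  have "U = {}" if "openin X U" "U \<subseteq> C - X interior_of C" for U
    using that interior_of_maximal[of U C X] by blast
  then show "X interior_of (C - X interior_of C) = {}"
    by (simp add: interior_of_eq_empty)
qed

lemma meagre_in_homeomorphic_image:
  assumes hom: "homeomorphic_map X Y h" and "meagre_in X S"
  shows "meagre_in Y (h ` S)"
proof -
  obtain \<F> where \<F>: "countable \<F>"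
    "\<And>C. C \<in> \<F> \<Longrightarrow> closedin X C \<and> X interior_of C = {}" "S \<subseteq> \<Union>\<F>"
    using assms(2) unfolding meagre_in_def by blast
  have "closedin Y (h ` C) \<and> Y interior_of (h ` C) = {}" if "C \<in> \<F>" for C
    using \<F>(2)[OF that] homeomorphic_map_closedness_eq[OF hom]
      homeomorphic_map_interior_of[OF hom] closedin_subset by fastforce
  moreover have "h ` S \<subseteq> \<Union>((`) h ` \<F>)"
    using \<F>(3) by (simp add: image_mono flip: image_Union)
  ultimately show ?thesis
    unfolding meagre_in_def using \<F>(1) by (intro exI[of _ "(`) h ` \<F>"]) simp
qed

section \<open>Points of local nonmeagreness\<close>

text \<open>Kuratowski's set \<open>D(S)\<close> of points at which \<open>S\<close> is locally of
  second category. It serves as a closed approximation of \<open>S\<close>: for continuous images of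
  Polish spaces in Hausdorff spaces the two differ by meagre sets only.\<close>

definition nonmeagre_points :: "'a topology \<Rightarrow> 'a set \<Rightarrow> 'a set" where
  "nonmeagre_points X S =
     {y \<in> topspace X. \<forall>W. openin X W \<and> y \<in> W \<longrightarrow> \<not> meagre_in X (W \<inter> S)}"

lemma closedin_nonmeagre_points: "closedin X (nonmeagre_points X S)"
proof -
  have "topspace X - nonmeagre_points X S = \<Union>{W. openin X W \<and> meagre_in X (W \<inter> S)}"
    unfolding nonmeagre_points_def using openin_subset by fastforce
  then have "openin X (topspace X - nonmeagre_points X S)"
    by (metis (mono_tags, lifting) mem_Collect_eq openin_Union)
  then show ?thesis
    by (auto simp: closedin_def nonmeagre_points_def)
qed

section \<open>Continuous images of Polish spaces are almost open\<close>

lemma polish_imp_second_countable: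
  assumes "polish_topology P"
  shows "second_countable P"
proof -
  obtain M d where Md: "Metric_space M d" "P = Metric_space.mtopology M d"
    using assms unfolding polish_topology_def completely_metrizable_space_def by blast
  interpret Metric_space M d by fact
  obtain C where C: "countable C" "C \<subseteq> M" "mtopology closure_of C = M"
    using assms unfolding polish_topology_def separable_space_def Md(2) topspace_mtopology by metis
  define \<B> where "\<B> = (\<lambda>(c, n). mball c (inverse (Suc n))) ` (C \<times> (UNIV :: nat set))"
  have "\<exists>V\<in>\<B>. x \<in> V \<and> V \<subseteq> U" if U: "openin mtopology U" "x \<in> U" for U x
  proof -
    obtain r where r: "r > 0" "mball x r \<subseteq> U" "x \<in> M"
      using U unfolding openin_mtopology by blast
    \<comment> \<open>Half of \<open>r\<close> pays for the distance from \<open>x\<close> to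
      \<open>c\<close>, the other half for the radius of the ball around \<open>c\<close>.\<close>
    obtain n where n: "inverse (Suc n) < r / 2"
      using reals_Archimedean[of "r/2"] r(1) by auto
    have "x \<in> mtopology closure_of C"
      using C(3) r(3) by simp
    then have "\<forall>s>0. \<exists>c\<in>C. c \<in> mball x s"
      by (simp add: metric_closure_of)
    moreover have "inverse (real (Suc n)) > 0"
      by simp
    ultimately obtain c where c: "c \<in> C" "c \<in> mball x (inverse (Suc n))"
      by meson
    have "mball c (inverse (Suc n)) \<subseteq> mball x r"
    proof
      fix z assume z: "z \<in> mball c (inverse (Suc n))"
      then have "d x z \<le> d x c + d c z"
        using c r(3) triangle by auto
      with z c n r(3) show "z \<in> mball x r"
        by auto
    qed
    moreover have "x \<in> mball c (inverse (Suc n))"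
      using c(2) by (auto simp: commute)
    ultimately show ?thesis
      using c(1) r(2) unfolding \<B>_def by blast
  qed
  moreover have "countable \<B>" "\<forall>V\<in>\<B>. openin mtopology V"
    unfolding \<B>_def using C(1) by auto
  ultimately show ?thesis
    unfolding second_countable_def Md(2) by blast
qed

text \<open>Open sets are G-delta, and complete metrizability passes to G-delta subspaces. This
  makes the preimage of an open subset of the group a Polish space again.\<close>

lemma polish_topology_openin:
  assumes "polish_topology P" "openin P U"
  shows "polish_topology (subtopology P U)"
  using assms unfolding polish_topology_def
  by (simp add: separable_space_open_subset completely_metrizable_space_gdelta_in open_imp_gdelta_in)

text \<open>Second countability of \<open>P\<close> replaces the Banach category theorem here.\<close>

lemma meagre_in_diff_nonmeagre_points:
  assumes "second_countable P" and h: "continuous_map P X h" and B: "openin P B"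
  shows "meagre_in X (h ` B - nonmeagre_points X (h ` B))"
proof -
  obtain \<B> where \<B>: "countable \<B>"
    "\<And>U x. openin P U \<Longrightarrow> x \<in> U \<Longrightarrow> \<exists>V\<in>\<B>. x \<in> V \<and> V \<subseteq> U"
    using assms(1) unfolding second_countable_def by metis
  \<comment> \<open>Only countably many basic sets have a meagre image, and these images will cover
    the difference.\<close>
  let ?I = "{V \<in> \<B>. meagre_in X (h ` V)}"
  have "y \<in> (\<Union>V\<in>?I. h ` V)" if y: "y \<in> h ` B" "y \<notin> nonmeagre_points X (h ` B)" for y
  proof -
    obtain p where p: "p \<in> B" "y = h p"
      using y by blast
    have pP: "p \<in> topspace P"
      using B p openin_subset by blast
    then have "y \<in> topspace X"
      using h p by (simp add: continuous_map_def Pi_iff)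
    then obtain W where W: "openin X W" "y \<in> W" "meagre_in X (W \<inter> h ` B)"
      using y(2) unfolding nonmeagre_points_def by blast
    have "openin P (B \<inter> {q \<in> topspace P. h q \<in> W})"
      by (intro openin_Int B openin_continuous_map_preimage[OF h W(1)])
    then obtain V where V: "V \<in> \<B>" "p \<in> V" "V \<subseteq> B \<inter> {q \<in> topspace P. h q \<in> W}"
      using \<B>(2) p W(2) pP by (metis (mono_tags, lifting) IntI mem_Collect_eq)
    then have "meagre_in X (h ` V)"
      by (intro meagre_in_subset[OF W(3)]) auto
    with V p show ?thesis by blast
  qed
  then have "h ` B - nonmeagre_points X (h ` B) \<subseteq> (\<Union>V\<in>?I. h ` V)"
    by blast
  moreover have "meagre_in X (\<Union>V\<in>?I. h ` V)"
    using \<B>(1) by (intro meagre_in_UN) auto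
  ultimately show ?thesis
    by (rule meagre_in_subset[rotated])
qed

text \<open>The set is closed, so only an open \<open>W\<close> inside it has to be excluded. A
  point of \<open>W\<close> in the image of \<open>B\<close> lies in the image of some
  \<open>C\<close> but not in the interior of \<open>?D C\<close>, hence in one of countably many
  meagre sets. So the image of \<open>B\<close> is meagre in \<open>W\<close>, which is impossible
  near a point of \<open>?D B\<close>.\<close>

lemma meagre_in_nonmeagre_points_diff_cover:
  assumes "countable \<C>" and BC: "B \<subseteq> \<Union>\<C>"
    and \<C>: "\<And>C. C \<in> \<C> \<Longrightarrow> meagre_in X (h ` C - nonmeagre_points X (h ` C))"
  shows "meagre_in X (nonmeagre_points X (h ` B) -
           (\<Union>C\<in>\<C>. X interior_of nonmeagre_points X (h ` C)))"
    (is "meagre_in X ?F")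
proof (rule meagre_in_nowhere_dense)
  let ?D = "\<lambda>C. nonmeagre_points X (h ` C)"
  show "closedin X ?F"
    by (intro closedin_diff closedin_nonmeagre_points openin_Union) auto
  show "X interior_of ?F = {}"
  proof (rule ccontr)
    define W where "W = X interior_of ?F"
    assume "X interior_of ?F \<noteq> {}"
    then obtain y where y: "y \<in> W"
      unfolding W_def by blast
    have W: "openin X W" "W \<subseteq> ?F"
      unfolding W_def by (simp_all add: interior_of_subset)
    have "W \<inter> h ` B \<subseteq> (\<Union>C\<in>\<C>. (h ` C - ?D C) \<union> (?D C - X interior_of ?D C))"
    proof
      fix z assume z: "z \<in> W \<inter> h ` B"
      then obtain C where C: "C \<in> \<C>" "z \<in> h ` C"
        using BC by auto
      moreover have "z \<notin> X interior_of ?D C"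
        using z W(2) C(1) by auto
      ultimately show "z \<in> (\<Union>C\<in>\<C>. (h ` C - ?D C) \<union> (?D C - X interior_of ?D C))"
        by auto
    qed
    moreover have "meagre_in X (\<Union>C\<in>\<C>. (h ` C - ?D C) \<union> (?D C - X interior_of ?D C))"
      by (intro meagre_in_UN meagre_in_Un assms meagre_in_closedin_diff_interior
          closedin_nonmeagre_points)
    ultimately have "meagre_in X (W \<inter> h ` B)"
      by (rule meagre_in_subset[rotated])
    moreover have "y \<in> ?D B"
      using y W(2) by blast
    ultimately show False
      using W(1) y unfolding nonmeagre_points_def by blast
  qed
qed

text \<open>This is the hard half of the Baire property of the image. Off a countable union of
  meagre exceptional sets, a point \<open>y\<close> of local nonmeagreness can be followed down a
  nested sequence of shrinking basic sets whose images stay nonmeagre near \<open>y\<close>.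
  Completeness yields a limit point \<open>p\<close>, and continuity together with the Hausdorff
  property gives \<open>h p = y\<close>.\<close>

lemma meagre_in_nonmeagre_points_diff:
  assumes P: "polish_topology P" and X: "Hausdorff_space X" and h: "continuous_map P X h"
  shows "meagre_in X (nonmeagre_points X (h ` topspace P) - h ` topspace P)"
proof -
  obtain M d where Md: "Metric_space M d" "P = Metric_space.mtopology M d"
      "Metric_space.mcomplete M d"
    using P unfolding polish_topology_def completely_metrizable_space_def by blast
  interpret Metric_space M d by fact
  have sc: "second_countable P"
    using P by (rule polish_imp_second_countable)
  obtain \<B>\<^sub>0 where \<B>\<^sub>0: "countable \<B>\<^sub>0" "\<And>V. V \<in> \<B>\<^sub>0 \<Longrightarrow> openin P V"
    "\<And>U x. openin P U \<Longrightarrow> x \<in> U \<Longrightarrow> \<exists>V\<in>\<B>\<^sub>0. x \<in> V \<and> V \<subseteq> U"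
    using sc unfolding second_countable_def by metis
  \<comment> \<open>The whole space is added so that the descent can start from it.\<close>
  define \<B> where "\<B> = insert M \<B>\<^sub>0"
  have top: "topspace P = M"
    using Md(2) by simp
  have \<B>: "countable \<B>" "\<And>V. V \<in> \<B> \<Longrightarrow> openin P V"
    "\<And>U x. openin P U \<Longrightarrow> x \<in> U \<Longrightarrow> \<exists>V\<in>\<B>. x \<in> V \<and> V \<subseteq> U"
    unfolding \<B>_def using \<B>\<^sub>0 top by auto
  \<comment> \<open>These are the admissible successors of \<open>B\<close> at stage
    \<open>n\<close>: basic subsets whose size is controlled by \<open>n\<close>. They still cover
    \<open>B\<close>.\<close>
  define \<C> where "\<C> B n = {C \<in> \<B>. C \<subseteq> B \<and> (\<exists>a. C \<subseteq> mcball a (inverse (Suc n)))}"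
    for B and n :: nat
  let ?D = "\<lambda>C. nonmeagre_points X (h ` C)"
  \<comment> \<open>The points at which the descent from \<open>B\<close> may get stuck at stage
    \<open>n\<close>.\<close>
  define F where "F B n = ?D B - (\<Union>C\<in>\<C> B n. X interior_of ?D C)" for B and n :: nat
  have "meagre_in X (F B n)" if "B \<in> \<B>" for B n
    unfolding F_def
  proof (rule meagre_in_nonmeagre_points_diff_cover)
    show "countable (\<C> B n)"
      unfolding \<C>_def using \<B>(1) by auto
    show "B \<subseteq> \<Union>(\<C> B n)"
    proof
      fix p assume p: "p \<in> B"
      then have "p \<in> M"
        using \<B>(2)[OF that] openin_subset top by blast
      then have "openin P (B \<inter> mball p (inverse (Suc n)))" "p \<in> B \<inter> mball p (inverse (Suc n))"
        using \<B>(2)[OF that] p Md(2) by auto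
      then obtain C where "C \<in> \<B>" "p \<in> C" "C \<subseteq> B \<inter> mball p (inverse (Suc n))"
        using \<B>(3) by blast
      then show "p \<in> \<Union>(\<C> B n)"
        unfolding \<C>_def using mball_subset_mcball by blast
    qed
    show "meagre_in X (h ` C - ?D C)" if "C \<in> \<C> B n" for C
      using that \<B>(2) by (intro meagre_in_diff_nonmeagre_points[OF sc h]) (auto simp: \<C>_def)
  qed
  then have m: "meagre_in X (\<Union>B\<in>\<B>. \<Union>n. F B n)"
    using \<B>(1) by (intro meagre_in_UN) auto
  have "y \<in> h ` M" if y: "y \<in> ?D M" and nF: "y \<notin> (\<Union>B\<in>\<B>. \<Union>n. F B n)" for y
  proof -
    \<comment> \<open>Since \<open>y\<close> avoids \<open>F B n\<close>, it lies in the interior of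
      \<open>?D C\<close> for some successor \<open>C\<close>, so the descent never stops.\<close>
    have "\<exists>B. \<forall>n. (B n \<in> \<B> \<and> y \<in> ?D (B n)) \<and> B (Suc n) \<in> \<C> (B n) n"
    proof (rule dependent_nat_choice)
      show "\<exists>B. B \<in> \<B> \<and> y \<in> ?D B"
        using y \<B>_def by auto
      show "\<exists>C. (C \<in> \<B> \<and> y \<in> ?D C) \<and> C \<in> \<C> B n" if By: "B \<in> \<B> \<and> y \<in> ?D B" for B n
      proof -
        have "y \<notin> F B n"
          using nF By by blast
        then obtain C where "C \<in> \<C> B n" "y \<in> X interior_of ?D C"
          using By unfolding F_def by blast
        then show ?thesis
          using interior_of_subset[of X "?D C"] unfolding \<C>_def by blast
      qed
    qed
    then obtain B where B: "\<And>n. B n \<in> \<B>" "\<And>n. y \<in> ?D (B n)" "\<And>n. B (Suc n) \<in> \<C> (B n) n"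
      by blast
    have dec: "decseq B"
      using B(3) unfolding \<C>_def by (intro decseq_SucI) auto
    have BM: "B n \<subseteq> M" for n
      using B(1) \<B>(2) openin_subset top by blast
    \<comment> \<open>Passing to closures allows Cantor's intersection theorem to be applied; the
      balls in the definition of \<open>\<C>\<close> are closed, so they contain these closures
      too.\<close>
    define K where "K n = mtopology closure_of (B n)" for n
    \<comment> \<open>The intersection is even nonmeagre, because \<open>y\<close> lies in
      \<open>?D (B n)\<close>.\<close>
    have meet: "W \<inter> h ` B n \<noteq> {}" if "openin X W" "y \<in> W" for W n
      using B(2)[of n] that unfolding nonmeagre_points_def by fastforce
    have yX: "y \<in> topspace X"
      using y unfolding nonmeagre_points_def by blast
    have BK: "B n \<subseteq> K n" for n
      unfolding K_def using BM by (simp add: closure_of_subset)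
    \<comment> \<open>The index is shifted because stage \<open>n\<close> bounds the successor
      \<open>B (Suc n)\<close>; no bound is claimed for \<open>B 0\<close>.\<close>
    have small: "\<exists>a. K (Suc n) \<subseteq> mcball a (inverse (Suc n))" for n
    proof -
      obtain a where "B (Suc n) \<subseteq> mcball a (inverse (Suc n))"
        using B(3)[of n] unfolding \<C>_def by blast
      then show ?thesis
        unfolding K_def by (intro exI[of _ a] closure_of_minimal closedin_mcball)
    qed
    have "\<Inter>(range K) \<noteq> {}"
    proof (rule mcomplete_nest[THEN iffD1, rule_format, OF Md(3)], intro conjI allI impI)
      show "closedin mtopology (K n)" for n
        unfolding K_def by simp
      show "K n \<noteq> {}" for n
        using BK[of n] meet[OF openin_topspace yX, of n] by blast
      show "decseq K"
        using dec unfolding K_def decseq_def by (simp add: closure_of_mono)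
      show "\<exists>n a. K n \<subseteq> mcball a \<epsilon>" if "\<epsilon> > 0" for \<epsilon>
      proof -
        obtain n where "inverse (real (Suc n)) < \<epsilon>"
          using reals_Archimedean \<open>\<epsilon> > 0\<close> by blast
        then show ?thesis
          using small[of n] mcball_subset_concentric[of "inverse (real (Suc n))" \<epsilon>]
          by (meson less_imp_le order.trans)
      qed
    qed
    then obtain p where p: "\<And>n. p \<in> K n"
      by blast
    have pM: "p \<in> M"
      using p[of 0] closure_of_subset_topspace[of mtopology] unfolding K_def by auto
    have "h p = y"
    proof (rule ccontr)
      assume "h p \<noteq> y"
      moreover have "h p \<in> topspace X"
        using h pM top by (simp add: continuous_map_def Pi_iff)
      \<comment> \<open>A small \<open>B (Suc n)\<close> near \<open>p\<close> is mapped into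
        \<open>U\<close>, while its image must meet the neighbourhood \<open>W\<close> of
        \<open>y\<close>: this contradicts disjointness.\<close>
      ultimately obtain U W where UW: "openin X U" "openin X W" "h p \<in> U" "y \<in> W" "disjnt U W"
        using X yX unfolding Hausdorff_space_def by metis
      have "openin mtopology {q \<in> topspace P. h q \<in> U}"
        using h UW(1) Md(2) openin_continuous_map_preimage by fastforce
      then obtain r where r: "r > 0" "mball p r \<subseteq> {q \<in> topspace P. h q \<in> U}"
        using UW(3) pM top unfolding openin_mtopology by blast
      obtain n where n: "inverse (real (Suc n)) < r / 2"
        using reals_Archimedean[of "r/2"] r(1) by auto
      obtain a where a: "K (Suc n) \<subseteq> mcball a (inverse (Suc n))"
        using small by blast
      have "B (Suc n) \<subseteq> mball p r"
      proof
        fix q assume "q \<in> B (Suc n)"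
        then have q: "q \<in> mcball a (inverse (Suc n))"
          using a BK by blast
        have pa: "p \<in> mcball a (inverse (Suc n))"
          using a p by blast
        have "d p q \<le> d p a + d a q"
          using q pa by (intro triangle) auto
        then show "q \<in> mball p r"
          using q pa n by (auto simp: commute)
      qed
      then have "h ` B (Suc n) \<subseteq> U"
        using r(2) by blast
      then show False
        using meet[OF UW(2,4), of "Suc n"] UW(5) by (auto simp: disjnt_def)
    qed
    with pM show ?thesis by blast
  qed
  then have "?D M - h ` M \<subseteq> (\<Union>B\<in>\<B>. \<Union>n. F B n)"
    by (intro subsetI) (metis DiffE)
  then show ?thesis
    unfolding top by (rule meagre_in_subset[OF m])
qed

text \<open>The interior of the set of local nonmeagreness serves as \<open>W\<close>. The part of
  the image outside it is meagre, so a nonmeagre image must meet it.\<close>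

lemma nonmeagre_polish_image_comeagre_on_open:
  assumes P: "polish_topology P" and X: "Hausdorff_space X" and h: "continuous_map P X h"
    and nm: "\<not> meagre_in X (h ` topspace P)"
  obtains W where "openin X W" "W \<inter> h ` topspace P \<noteq> {}" "meagre_in X (W - h ` topspace P)"
proof
  let ?A = "h ` topspace P"
  let ?D = "nonmeagre_points X ?A"
  let ?W = "X interior_of ?D"
  show "openin X ?W"
    by simp
  have "?W - ?A \<subseteq> ?D - ?A"
    by (intro Diff_mono interior_of_subset order_refl)
  then show "meagre_in X (?W - ?A)"
    by (rule meagre_in_subset[OF meagre_in_nonmeagre_points_diff[OF P X h]])
  have "meagre_in X (?A - ?D)"
    using polish_imp_second_countable[OF P] h openin_topspace
    by (rule meagre_in_diff_nonmeagre_points)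
  moreover have "meagre_in X (?D - ?W)"
    by (intro meagre_in_closedin_diff_interior closedin_nonmeagre_points)
  ultimately have "meagre_in X ((?A - ?D) \<union> (?D - ?W))"
    by (rule meagre_in_Un)
  then have "\<not> ?A \<subseteq> (?A - ?D) \<union> (?D - ?W)"
    using nm by (blast dest: meagre_in_subset)
  then show "?W \<inter> ?A \<noteq> {}"
    by auto
qed

section \<open>Topological groups\<close>

locale top_group = group G for G (structure) +
  fixes T :: "'a topology"
  assumes topspace_eq: "topspace T = carrier G"
    and continuous_div: "continuous_map (prod_topology T T) T (\<lambda>(x, y). x \<otimes> inv y)"
begin

text \<open>Inversion and left translation are obtained from this by writing them as quotients, the
  form in which the group axiom provides continuity.\<close>

lemma continuous_div_comp:
  assumes "continuous_map S T f" "continuous_map S T g"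
  shows "continuous_map S T (\<lambda>x. f x \<otimes> inv g x)"
  using continuous_map_compose[OF continuous_map_pairedI[OF assms] continuous_div]
  by (simp add: o_def)

lemma continuous_inv: "continuous_map T T (\<lambda>x. inv x)"
proof (rule continuous_map_eq)
  show "continuous_map T T (\<lambda>x. \<one> \<otimes> inv x)"
    by (intro continuous_div_comp) (auto simp: topspace_eq continuous_map_id[unfolded id_def])
qed (auto simp: topspace_eq)

lemma continuous_mult_left:
  assumes "g \<in> carrier G"
  shows "continuous_map T T (\<lambda>x. g \<otimes> x)"
proof (rule continuous_map_eq)
  show "continuous_map T T (\<lambda>x. g \<otimes> inv (inv x))"
    using assms by (intro continuous_div_comp continuous_inv) (auto simp: topspace_eq)
qed (auto simp: topspace_eq)

lemma openin_mult_left_preimage: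
  assumes "g \<in> carrier G" "openin T U"
  shows "openin T {x \<in> carrier G. g \<otimes> x \<in> U}"
  using openin_continuous_map_preimage[OF continuous_mult_left assms(2)] assms(1)
  by (simp add: topspace_eq)

lemma neighbourhood_inv_mult:
  assumes U: "openin T U" "\<one> \<in> U"
  obtains V where "openin T V" "\<one> \<in> V" "\<And>a b. a \<in> V \<Longrightarrow> b \<in> V \<Longrightarrow> inv a \<otimes> b \<in> U"
proof -
  let ?S = "{z \<in> topspace (prod_topology T T). (case z of (x, y) \<Rightarrow> x \<otimes> inv y) \<in> U}"
  have "openin (prod_topology T T) ?S"
    using continuous_div U(1) by (rule openin_continuous_map_preimage)
  moreover have "(\<one>, \<one>) \<in> ?S"
    using U(2) by (simp add: topspace_eq)
  ultimately obtain A B where AB: "openin T A" "openin T B" "\<one> \<in> A" "\<one> \<in> B" "A \<times> B \<subseteq> ?S"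
    by (blast dest: openin_prod_topology_alt[THEN iffD1, THEN spec, THEN spec, THEN mp])
  \<comment> \<open>Continuity controls products \<open>x \<otimes> inv y\<close>, whereas
    \<open>inv a \<otimes> b\<close> is wanted; taking inverses turns one form into the
    other.\<close>
  let ?V = "{x \<in> carrier G. inv x \<in> A \<inter> B}"
  show thesis
  proof
    show "openin T ?V"
      using openin_continuous_map_preimage[OF continuous_inv openin_Int[OF AB(1,2)]]
      by (simp add: topspace_eq)
    show "\<one> \<in> ?V"
      using AB by simp
    show "inv a \<otimes> b \<in> U" if "a \<in> ?V" "b \<in> ?V" for a b
    proof -
      have "(inv a, inv b) \<in> ?S"
        using AB(5) that by blast
      then show ?thesis
        using that by simp
    qed
  qed
qed

end

lemma top_group_iff: "top_group G T \<longleftrightarrow> topological_group G T"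
  by (auto simp: topological_group_def top_group_def top_group_axioms_def)

section \<open>Actions with nonmeagre orbits\<close>

text \<open>The Polish parametrisation of the group is fixed as data, so that orbits of open subsets
  of the group can be treated as images of open subspaces of \<open>P\<close>.\<close>

locale suslin_nonmeagre_action = top_group G T + group_action G "topspace X" \<phi>
  for G (structure) and T and X :: "'x topology" and \<phi> +
  fixes P :: "'p topology" and f
  assumes polish: "polish_topology P"
    and f: "continuous_map P T f" "f ` topspace P = topspace T"
    and Hausdorff: "Hausdorff_space X"
    and sep_cont: "separately_continuous_map T X X \<phi>"
    and nonmeagre_orbit: "x \<in> topspace X \<Longrightarrow> \<not> meagre_in X (orbit G \<phi> x)"
begin

lemma continuous_orbit_map: "x \<in> topspace X \<Longrightarrow> continuous_map T X (\<lambda>g. \<phi> g x)"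
  using sep_cont unfolding separately_continuous_map_def by blast

lemma action_closed: "g \<in> carrier G \<Longrightarrow> x \<in> topspace X \<Longrightarrow> \<phi> g x \<in> topspace X"
  using element_image by blast

lemma action_one: "x \<in> topspace X \<Longrightarrow> \<phi> \<one> x = x"
  using id_eq_one by (metis restrict_apply')

lemma homeomorphic_action:
  assumes "g \<in> carrier G"
  shows "homeomorphic_map X X (\<phi> g)"
proof -
  have "\<phi> (inv g) (\<phi> g x) = x" "\<phi> g (\<phi> (inv g) x) = x" if "x \<in> topspace X" for x
    using assms that composition_rule[symmetric] action_one by auto
  then have "homeomorphic_maps X X (\<phi> g) (\<phi> (inv g))"
    using assms sep_cont
    unfolding homeomorphic_maps_def separately_continuous_map_def topspace_eq by auto
  then show ?thesis
    using homeomorphic_map_maps by blast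
qed

section \<open>Category on neighbourhood orbits\<close>

text \<open>The group is Lindelof as a continuous image of a second countable space, so countably
  many translates of \<open>V\<close> cover it. If V.x were meagre, its images under the
  homeomorphisms \<open>\<phi> g\<close> would make the whole orbit meagre.\<close>

lemma nonmeagre_neighbourhood_orbit:
  assumes V: "openin T V" "\<one> \<in> V" and x: "x \<in> topspace X"
  shows "\<not> meagre_in X ((\<lambda>g. \<phi> g x) ` V)"
proof
  assume m: "meagre_in X ((\<lambda>g. \<phi> g x) ` V)"
  have "Lindelof_space (subtopology T (topspace T))"
    using Lindelof_space_continuous_map_image[OF second_countable_imp_Lindelof_space f]
      polish_imp_second_countable[OF polish] by simp
  then have "Lindelof_space T"
    by simp
  \<comment> \<open>This is the translate gV, written as a preimage under left multiplication by
    \<open>inv g\<close> so that its openness follows from continuity.\<close>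
  define tr where "tr g = {h \<in> carrier G. inv g \<otimes> h \<in> V}" for g
  have "openin T (tr g)" "g \<in> tr g" if "g \<in> carrier G" for g
    unfolding tr_def using openin_mult_left_preimage[of "inv g"] that V by auto
  then have "(\<forall>U\<in>tr ` carrier G. openin T U) \<and> \<Union>(tr ` carrier G) = topspace T"
    unfolding topspace_eq using openin_subset topspace_eq by (auto simp: tr_def)
  then obtain \<V> where "countable \<V>" "\<V> \<subseteq> tr ` carrier G" "\<Union>\<V> = topspace T"
    using \<open>Lindelof_space T\<close> unfolding Lindelof_space_def by metis
  then obtain I where I: "countable I" "I \<subseteq> carrier G" "\<Union>(tr ` I) = carrier G"
    by (metis countable_subset_image topspace_eq)
  have "orbit G \<phi> x \<subseteq> (\<Union>g\<in>I. \<phi> g ` (\<lambda>g. \<phi> g x) ` V)"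
  proof
    fix y assume "y \<in> orbit G \<phi> x"
    then obtain h where h: "h \<in> carrier G" "y = \<phi> h x"
      unfolding orbit_def by blast
    then obtain g where g: "g \<in> I" "h \<in> tr g"
      using I by blast
    have "h = g \<otimes> (inv g \<otimes> h)"
      using g I h by (metis inv_solve_left' m_closed inv_closed subsetD)
    then have "y = \<phi> g (\<phi> (inv g \<otimes> h) x)"
      using composition_rule[OF x, of g "inv g \<otimes> h"] h g I(2) by auto
    then show "y \<in> (\<Union>g\<in>I. \<phi> g ` (\<lambda>g. \<phi> g x) ` V)"
      using g unfolding tr_def by blast
  qed
  moreover have "meagre_in X (\<Union>g\<in>I. \<phi> g ` (\<lambda>g. \<phi> g x) ` V)"
    using I by (intro meagre_in_UN meagre_in_homeomorphic_image[OF homeomorphic_action m]) auto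
  ultimately show False
    using nonmeagre_orbit[OF x] by (auto dest: meagre_in_subset)
qed

text \<open>Thus \<open>X\<close> is a Baire space. For \<open>y\<close> in \<open>W\<close>, the
  group elements moving \<open>y\<close> into \<open>W\<close> form an identity neighbourhood, whose
  orbit of \<open>y\<close> is nonmeagre and contained in \<open>W\<close>.\<close>

lemma nonmeagre_openin:
  assumes "openin X W" "W \<noteq> {}"
  shows "\<not> meagre_in X W"
proof -
  obtain y where y: "y \<in> W" "y \<in> topspace X"
    using assms openin_subset by blast
  have "openin T {g \<in> topspace T. \<phi> g y \<in> W}"
    using continuous_orbit_map[OF y(2)] assms(1) by (rule openin_continuous_map_preimage)
  then have "\<not> meagre_in X ((\<lambda>g. \<phi> g y) ` {g \<in> topspace T. \<phi> g y \<in> W})"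
    by (rule nonmeagre_neighbourhood_orbit) (use y action_one topspace_eq in auto)
  then show ?thesis
    by (rule contrapos_nn) (erule meagre_in_subset, auto)
qed

text \<open>For \<open>V\<close> with V\<inverse>V inside \<open>U\<close>, the set V.x is comeagre
  in some open \<open>W\<close> that it meets, say at g.x with \<open>g\<close> in \<open>V\<close>.
  Translating by \<open>inv g\<close> moves this point to \<open>x\<close> and V.x into U.x.\<close>

lemma orbit_comeagre_near:
  assumes U: "openin T U" "\<one> \<in> U" and x: "x \<in> topspace X"
  obtains N where "openin X N" "x \<in> N" "meagre_in X (N - (\<lambda>g. \<phi> g x) ` U)"
proof -
  obtain V where V: "openin T V" "\<one> \<in> V" "\<And>a b. a \<in> V \<Longrightarrow> b \<in> V \<Longrightarrow> inv a \<otimes> b \<in> U"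
    using neighbourhood_inv_mult[OF U] by blast
  have VG: "V \<subseteq> carrier G"
    using V(1) openin_subset topspace_eq by blast
  \<comment> \<open>The open subspace \<open>R\<close> is Polish and is mapped onto \<open>V\<close>
    by \<open>f\<close>; composing with the orbit map exhibits V.x as a continuous Polish
    image.\<close>
  define R where "R = {p \<in> topspace P. f p \<in> V}"
  have R: "openin P R"
    unfolding R_def using f(1) V(1) by (rule openin_continuous_map_preimage)
  then have RP: "R \<subseteq> topspace P"
    by (rule openin_subset)
  have "V \<subseteq> f ` topspace P"
    using VG f(2) topspace_eq by simp
  then have fR: "f ` R = V"
    unfolding R_def by auto
  define h where "h = (\<lambda>g. \<phi> g x) \<circ> f"
  have "continuous_map (subtopology P R) X h"
    unfolding h_def
    by (intro continuous_map_from_subtopology continuous_map_compose[OF f(1)]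
        continuous_orbit_map x)
  moreover have hV: "h ` topspace (subtopology P R) = (\<lambda>g. \<phi> g x) ` V"
    unfolding h_def fR[symmetric] using RP by (auto simp: image_comp inf_absorb2)
  ultimately obtain W where W: "openin X W" "W \<inter> (\<lambda>g. \<phi> g x) ` V \<noteq> {}"
      "meagre_in X (W - (\<lambda>g. \<phi> g x) ` V)"
    using nonmeagre_polish_image_comeagre_on_open[OF polish_topology_openin[OF polish R] Hausdorff]
      nonmeagre_neighbourhood_orbit[OF V(1,2) x] by metis
  obtain g where g: "g \<in> V" "\<phi> g x \<in> W"
    using W(2) by blast
  then have gG: "g \<in> carrier G" "inv g \<in> carrier G"
    using VG by auto
  define N where "N = \<phi> (inv g) ` W"
  show thesis
  proof
    show "openin X N"
      unfolding N_def using homeomorphic_imp_open_map[OF homeomorphic_action[OF gG(2)]] W(1)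
      by (simp add: open_map_def)
    have "\<phi> (inv g) (\<phi> g x) = x"
      using gG x composition_rule[symmetric] action_one by auto
    then show "x \<in> N"
      unfolding N_def using g(2) by force
    have "N - (\<lambda>g. \<phi> g x) ` U \<subseteq> \<phi> (inv g) ` (W - (\<lambda>g. \<phi> g x) ` V)"
    proof
      fix z assume z: "z \<in> N - (\<lambda>g. \<phi> g x) ` U"
      then obtain w where w: "w \<in> W" "z = \<phi> (inv g) w"
        unfolding N_def by blast
      have "z = \<phi> (inv g \<otimes> v) x" if "v \<in> V" "w = \<phi> v x" for v
        using w(2) that composition_rule[OF x gG(2), of v] VG by auto
      then have "w \<notin> (\<lambda>g. \<phi> g x) ` V"
        using z V(3)[OF g(1)] by blast
      then show "z \<in> \<phi> (inv g) ` (W - (\<lambda>g. \<phi> g x) ` V)"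
        using w by blast
    qed
    then show "meagre_in X (N - (\<lambda>g. \<phi> g x) ` U)"
      by (rule meagre_in_subset[OF
            meagre_in_homeomorphic_image[OF homeomorphic_action[OF gG(2)] W(3)]])
  qed
qed

section \<open>From comeagre to open\<close>

text \<open>Being comeagre near \<open>x\<close> is improved to containing a neighbourhood by
  comparing with every \<open>y\<close> in \<open>N\<close>. Such a \<open>y\<close> is not known in
  advance to lie in the orbit of \<open>x\<close>, so nonmeagreness of its own orbit enters
  here.\<close>

lemma micro_transitive:
  assumes U: "openin T U" "\<one> \<in> U" and x: "x \<in> topspace X"
  obtains N where "openin X N" "x \<in> N" "N \<subseteq> (\<lambda>g. \<phi> g x) ` U"
proof -
  obtain V where V: "openin T V" "\<one> \<in> V" "\<And>a b. a \<in> V \<Longrightarrow> b \<in> V \<Longrightarrow> inv a \<otimes> b \<in> U"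
    using neighbourhood_inv_mult[OF U] by blast
  have VG: "V \<subseteq> carrier G"
    using V(1) openin_subset topspace_eq by blast
  obtain N where N: "openin X N" "x \<in> N" "meagre_in X (N - (\<lambda>g. \<phi> g x) ` V)"
    using orbit_comeagre_near[OF V(1,2) x] by blast
  have "y \<in> (\<lambda>g. \<phi> g x) ` U" if "y \<in> N" for y
  proof -
    have y: "y \<in> topspace X"
      using that N(1) openin_subset by blast
    obtain N' where N': "openin X N'" "y \<in> N'" "meagre_in X (N' - (\<lambda>g. \<phi> g y) ` V)"
      using orbit_comeagre_near[OF V(1,2) y] by blast
    have "\<not> meagre_in X (N \<inter> N')"
      using N(1) N'(1,2) that by (intro nonmeagre_openin) auto
    \<comment> \<open>Two meagre sets cannot cover the nonempty open set
      \<open>N \<inter> N'\<close>, so V.x and V.y share a point v.x = w.y, whence y = (inv w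
      v).x.\<close>
    then have "\<not> N \<inter> N' \<subseteq> (N - (\<lambda>g. \<phi> g x) ` V) \<union> (N' - (\<lambda>g. \<phi> g y) ` V)"
      by (rule contrapos_nn) (rule meagre_in_subset[OF meagre_in_Un[OF N(3) N'(3)]])
    then obtain z where "z \<in> (\<lambda>g. \<phi> g x) ` V" "z \<in> (\<lambda>g. \<phi> g y) ` V"
      by blast
    then obtain v w where vw: "v \<in> V" "w \<in> V" "\<phi> v x = \<phi> w y"
      by (metis (no_types, lifting) imageE)
    then have G: "v \<in> carrier G" "w \<in> carrier G"
      using VG by auto
    have "\<phi> (inv w \<otimes> v) x = \<phi> (inv w) (\<phi> w y)"
      using composition_rule[OF x] G vw(3) by simp
    also have "\<dots> = y"
      using orbit_sym_aux[OF G(2) y refl] .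
    finally show ?thesis
      using V(3)[OF vw(2,1)] by force
  qed
  then show thesis
    using that N by blast
qed

lemma open_map_orbit_map:
  assumes x: "x \<in> topspace X"
  shows "open_map T X (\<lambda>g. \<phi> g x)"
  unfolding open_map_def
proof (intro allI impI)
  fix U assume U: "openin T U"
  then have UG: "U \<subseteq> carrier G"
    using openin_subset topspace_eq by blast
  show "openin X ((\<lambda>g. \<phi> g x) ` U)"
  proof (subst openin_subopen, intro ballI)
    fix y assume "y \<in> (\<lambda>g. \<phi> g x) ` U"
    then obtain g where g: "g \<in> U" "g \<in> carrier G" "y = \<phi> g x"
      using UG by blast
    \<comment> \<open>Translating \<open>U\<close> by \<open>inv g\<close> reduces openness at g.x
      to the case of an identity neighbourhood at \<open>x\<close>.\<close>
    let ?V = "{h \<in> carrier G. g \<otimes> h \<in> U}"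
    have "openin T ?V" "\<one> \<in> ?V"
      using openin_mult_left_preimage[OF g(2) U] g by auto
    then obtain N where N: "openin X N" "x \<in> N" "N \<subseteq> (\<lambda>g. \<phi> g x) ` ?V"
      using micro_transitive x by blast
    have "openin X (\<phi> g ` N)"
      using homeomorphic_imp_open_map[OF homeomorphic_action[OF g(2)]] N(1)
      by (simp add: open_map_def)
    moreover have "y \<in> \<phi> g ` N"
      using N(2) g(3) by blast
    moreover have "\<phi> g ` N \<subseteq> (\<lambda>g. \<phi> g x) ` U"
    proof
      fix z assume "z \<in> \<phi> g ` N"
      then obtain h where h: "h \<in> carrier G" "g \<otimes> h \<in> U" "z = \<phi> g (\<phi> h x)"
        using N(3) by blast
      then have "z = \<phi> (g \<otimes> h) x"
        using composition_rule[OF x g(2)] by simp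
      with h(2) show "z \<in> (\<lambda>g. \<phi> g x) ` U" by blast
    qed
    ultimately show "\<exists>N. openin X N \<and> y \<in> N \<and> N \<subseteq> (\<lambda>g. \<phi> g x) ` U"
      by blast
  qed
qed

lemma openin_orbit:
  assumes "x \<in> topspace X"
  shows "openin X (orbit G \<phi> x)"
proof -
  have "orbit G \<phi> x = (\<lambda>g. \<phi> g x) ` topspace T"
    unfolding orbit_def topspace_eq by blast
  then show ?thesis
    using open_map_orbit_map[OF assms] by (simp add: open_map_def)
qed

text \<open>Orbits partition the space, so the complement of one orbit is a union of other orbits,
  each of which is open.\<close>

lemma closedin_orbit:
  assumes x: "x \<in> topspace X"
  shows "closedin X (orbit G \<phi> x)"
proof -
  have sub: "orbit G \<phi> y \<subseteq> topspace X" if "y \<in> topspace X" for y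
    using that action_closed unfolding orbit_def by blast
  have "topspace X - orbit G \<phi> x = \<Union>(orbit G \<phi> ` (topspace X - orbit G \<phi> x))"
  proof (intro equalityI subsetI)
    fix z assume "z \<in> \<Union>(orbit G \<phi> ` (topspace X - orbit G \<phi> x))"
    then obtain y where y: "y \<in> topspace X" "y \<notin> orbit G \<phi> x" "z \<in> orbit G \<phi> y"
      by blast
    then have z: "z \<in> topspace X"
      using sub by blast
    then have "y \<in> orbit G \<phi> z"
      using orbit_sym y by blast
    then have "z \<notin> orbit G \<phi> x"
      using orbit_trans[OF x z y(1)] y(2) by blast
    with z show "z \<in> topspace X - orbit G \<phi> x" by blast
  qed (use orbit_refl in blast)
  moreover have "openin X (\<Union>(orbit G \<phi> ` (topspace X - orbit G \<phi> x)))"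
    using openin_orbit by (intro openin_Union) auto
  ultimately show ?thesis
    using sub[OF x] by (simp add: closedin_def)
qed

end

theorem theorem4p1:
  fixes G :: "('g, 'm) monoid_scheme"
    and T :: "'g topology"
    and X :: "'x topology"
    and \<phi> :: "'g \<Rightarrow> 'x \<Rightarrow> 'x"
  assumes "topological_group G T"
    and "suslin_space TYPE('p) T"
    and "Hausdorff_space X"
    and "group_action G (topspace X) \<phi>"
    and "separately_continuous_map T X X \<phi>"
    and "\<And>x. x \<in> topspace X \<Longrightarrow> \<not> meagre_in X (orbit G \<phi> x)"
  shows "(\<forall>x \<in> topspace X. open_map T X (\<lambda>g. \<phi> g x)) \<and>
         (\<forall>x \<in> topspace X. closedin X (orbit G \<phi> x) \<and> openin X (orbit G \<phi> x))"
proof -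
  obtain P :: "'p topology" and f where
    "polish_topology P" "continuous_map P T f" "f ` topspace P = topspace T"
    using assms(2) unfolding suslin_space_def by blast
  then interpret suslin_nonmeagre_action G T X \<phi> P f
    using assms
    by (auto simp: suslin_nonmeagre_action_def suslin_nonmeagre_action_axioms_def top_group_iff)
  show ?thesis
    using open_map_orbit_map closedin_orbit openin_orbit by blast
qed

end
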